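(* Let $m$ and $p$ be positive integers. For $1\le j<p$ put $$S_j=\sum_{\substack{\boldsymbol{\alpha}\in\mathbb{N}^p\\ |\boldsymbol{\alpha}|=m+p}}\ \sum_{1\leq k_{j+1}<\cdots<k_p}1^{-\alpha_1-\alpha_2-\cdots-\alpha_j}\,k_{j+1}^{-\alpha_{j+1}}\cdots k_{p-1}^{-\alpha_{p-1}}k_{p}^{-\alpha_p-1},$$ and put $S_p=\binom{m+p-1}{m}$. Then $$S_1-S_2+S_3-\cdots+(-1)^{p-1}S_p=\zeta(m+p)-\sum_{\ell=1}^{\infty}\frac{1}{\ell^{p-1}(\ell+1)^{m+1}}.$$
   Context: $\mathbb{N}$ denotes the set of positive integers. For a tuple $\boldsymbol{\alpha}=(\alpha_1,\ldots,\alpha_p)$ of positive integers, $|\boldsymbol{\alpha}|=\alpha_1+\cdots+\alpha_p$. The inner sum in $S_j$ runs over all strictly increasing tuples $(k_{j+1},\ldots,k_p)$ of positive integers; the factor $1^{-\alpha_1-\cdots-\alpha_j}$ equals $1$, and for $j=p-1$ the summand is $k_p^{-\alpha_p-1}$. $\zeta(s)=\sum_{n\ge1}n^{-s}$ is the Riemann zeta function. *)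

theory Defs
  imports "HOL-Analysis.Analysis"
begin

text \<open>Values of the Riemann zeta function on its half-line \<open>s > 1\<close> of real convergence.\<close>

definition zeta :: "real \<Rightarrow> real" where
  "zeta s = (\<Sum>\<^sub>\<infinity>n\<in>{1::nat..}. real n powr (- s))"

text \<open>Tuples are functions on their index set, extended by \<open>undefined\<close> outside of it,
  so that every tuple is represented exactly once.\<close>

definition compositions :: "nat \<Rightarrow> nat \<Rightarrow> (nat \<Rightarrow> nat) set" where
  "compositions p n = {\<alpha> \<in> {1..p} \<rightarrow>\<^sub>E {1..}. (\<Sum>i=1..p. \<alpha> i) = n}"

definition increasing_tuples :: "nat \<Rightarrow> nat \<Rightarrow> (nat \<Rightarrow> nat) set" where
  "increasing_tuples j p = {k \<in> {j+1..p} \<rightarrow>\<^sub>E {1..}. strict_mono_on {j+1..p} k}"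

text \<open>The inner series has nonnegative terms and converges because the exponents of
  \<open>k\<^sub>i\<close> are at least 1 for \<open>i < p\<close> and at least 2 for \<open>i = p\<close>; so the infinite sum
  never takes its default value. The second branch is only used for \<open>j = p\<close>.\<close>

definition S :: "nat \<Rightarrow> nat \<Rightarrow> nat \<Rightarrow> real" where
  "S m p j =
    (if j < p then
       (\<Sum>\<alpha>\<in>compositions p (m + p). \<Sum>\<^sub>\<infinity>k\<in>increasing_tuples j p.
          1 powi (- (\<Sum>i=1..j. int (\<alpha> i)))
          * (\<Prod>i=j+1..p-1. real (k i) powi (- int (\<alpha> i)))
          * real (k p) powi (- int (\<alpha> p) - 1))
     else real ((m + p - 1) choose m))"

end

theory Submission
  imports Defs
begin

text \<open>
  Collecting the sums over \<open>\<alpha>\<close> for all \<open>m\<close> in a power series in \<open>X\<close> turns \<open>S\<^sub>j\<close> into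
  the coefficient of \<open>X\<^sup>m\<close> in \<open>(1 - X)\<^sup>-\<^sup>j \<Sum>\<^sub>k 1 / ((k\<^sub>j\<^sub>+\<^sub>1 - X) \<cdots> (k\<^sub>p - X) k\<^sub>p)\<close>. By the sum formula for
  multiple zeta values the sum over \<open>k\<close> is \<open>Z\<^sub>r = \<Sum>\<^sub>n 1 / (n\<^sup>r (n - X))\<close>, where \<open>r = p - j\<close>.
  The alternating sum \<open>Q\<^sub>p\<close> of these series therefore satisfies \<open>(1 - X) Q\<^sub>p\<^sub>+\<^sub>1 = Z\<^sub>p - Q\<^sub>p\<close>, and so does
  \<open>\<Sum>\<^sub>n n\<^sup>1\<^sup>-\<^sup>p (1 / (n - X) - 1 / (n + 1 - X))\<close>, whose coefficients are the right-hand side of the theorem.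

  The sum formula itself is obtained from a generating function in a second variable \<open>y\<close> for the
  depth: it becomes
  \<open>\<Sum>\<^sub>n 1 / (n (n - x)) \<Prod>\<^sub>k\<^sub><\<^sub>n (1 + y / (k - x)) = \<Sum>\<^sub>n 1 / ((n - x) (n - y))\<close>,
  which is the interchange of summation in a double series that telescopes in both directions.
  All series involved have nonnegative terms for small \<open>x, y \<ge> 0\<close>, so coefficients can be
  compared one variable after the other.
\<close>

unbundle no vec_syntax
unbundle fps_syntax

section \<open>Coefficients of sums of power series with nonnegative terms\<close>

lemma sums_swap_nonneg:
  fixes f :: "nat \<Rightarrow> nat \<Rightarrow> real"
  assumes nonneg: "\<And>i j. f i j \<ge> 0"
    and row: "\<And>i. f i sums g i" and total: "g sums s"
  shows "summable (\<lambda>i. f i j)" and "(\<lambda>j. \<Sum>i. f i j) sums s"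
proof -
  have col: "summable (\<lambda>i. f i j)" for j
  proof (rule summable_comparison_test')
    show "summable g" using total by (rule sums_summable)
    show "norm (f i j) \<le> g i" if "i \<ge> 0" for i
    proof -
      have "sum (f i) {j} \<le> suminf (f i)"
        using row[of i] nonneg by (intro sum_le_suminf) (auto simp: sums_iff)
      then show ?thesis using row[of i] nonneg[of i j] by (simp add: sums_iff)
    qed
  qed
  show "summable (\<lambda>i. f i j)" by (rule col)
  have g0: "g i \<ge> 0" for i
    using row[of i] nonneg by (metis sums_iff suminf_nonneg)
  have row': "(f i has_sum g i) UNIV" for i
    using row nonneg by (rule sums_nonneg_imp_has_sum)
  have total': "(g has_sum s) UNIV"
    using total g0 by (rule sums_nonneg_imp_has_sum)
  have "(\<lambda>(i, j). f i j) summable_on (UNIV \<times> UNIV)"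
    by (rule summable_on_SigmaI[where g = g])
      (use row' total' nonneg in \<open>auto simp: summable_on_def\<close>)
  then have "((\<lambda>(i, j). f i j) has_sum s) (UNIV \<times> UNIV)"
    by (intro has_sum_SigmaI[where g = g]) (use row' total' in auto)
  then have swapped: "((\<lambda>(j, i). f i j) has_sum s) (UNIV \<times> UNIV)"
    by (subst (asm) has_sum_swap) simp
  have "((\<lambda>j. \<Sum>i. f i j) has_sum s) UNIV"
    by (rule has_sum_SigmaD[OF swapped])
      (use col nonneg in \<open>auto intro!: sums_nonneg_imp_has_sum summable_sums\<close>)
  then show "(\<lambda>j. \<Sum>i. f i j) sums s" by (rule has_sum_imp_sums)
qed

lemma powser_coeffs_unique:
  fixes a b :: "nat \<Rightarrow> real"
  assumes "\<delta> > 0"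
    and a: "\<And>x. 0 < x \<Longrightarrow> x \<le> \<delta> \<Longrightarrow> (\<lambda>m. a m * x ^ m) sums s x"
    and b: "\<And>x. 0 < x \<Longrightarrow> x \<le> \<delta> \<Longrightarrow> (\<lambda>m. b m * x ^ m) sums s x"
  shows "a m = b m"
proof (rule ccontr)
  assume "a m \<noteq> b m"
  define e where "e m = a m - b m" for m
  define M where "M = (LEAST m. e m \<noteq> 0)"
  have "e m \<noteq> 0" using \<open>a m \<noteq> b m\<close> by (simp add: e_def)
  then have M: "e M \<noteq> 0" "\<And>i. i < M \<Longrightarrow> e i = 0"
    unfolding M_def by (rule LeastI, meson not_less_Least)
  have e: "(\<lambda>m. e m * x ^ m) sums 0" if "0 < x" "x \<le> \<delta>" for x
    using sums_diff[OF a[OF that] b[OF that]] by (simp add: e_def algebra_simps)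
  have F: "(\<lambda>k. e (k + M) * x ^ k) sums 0" if "0 < x" "x \<le> \<delta>" for x
  proof -
    have "(\<lambda>k. e (k + M) * x ^ (k + M)) sums 0"
      using e[OF that] M(2) by (subst sums_iff_shift) simp
    from sums_mult[OF this, of "1 / x ^ M"] show ?thesis
      using that by (simp add: power_add field_simps)
  qed
  define f where "f x = (\<Sum>k. e (k + M) * x ^ k)" for x
  have "(\<lambda>k. e (k + M) * x ^ k) sums f x" if "norm x < \<delta>" for x
    unfolding f_def
    by (rule summable_sums, rule powser_inside[where x = \<delta>])
      (use F[of \<delta>] assms(1) that in \<open>auto simp: sums_iff\<close>)
  then have "(f \<longlongrightarrow> e (0 + M)) (at 0)"
    by (rule powser_limit_0[OF assms(1)])
  then have "(f \<longlongrightarrow> e M) (at_right 0)"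
    by (simp add: filterlim_at_split)
  moreover have "(f \<longlongrightarrow> 0) (at_right 0)"
  proof (rule tendsto_eventually)
    have "eventually (\<lambda>x. x \<in> {0<..<\<delta>}) (at_right 0)"
      using assms(1) by (rule eventually_at_right_real)
    then show "eventually (\<lambda>x. f x = 0) (at_right 0)"
      by eventually_elim (use F in \<open>auto simp: f_def sums_iff\<close>)
  qed
  ultimately have "e M = 0" by (intro tendsto_unique[of "at_right 0"]) auto
  with M(1) show False by simp
qed

lemma sums_powser_coeffs_transfer:
  fixes c d :: "nat \<Rightarrow> nat \<Rightarrow> real"
  assumes "\<delta> > 0" and nonneg: "\<And>n m. c n m \<ge> 0" "\<And>n m. d n m \<ge> 0"
    and c: "\<And>n x. 0 < x \<Longrightarrow> x \<le> \<delta> \<Longrightarrow> (\<lambda>m. c n m * x ^ m) sums f n x"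
    and d: "\<And>n x. 0 < x \<Longrightarrow> x \<le> \<delta> \<Longrightarrow> (\<lambda>m. d n m * x ^ m) sums g n x"
    and f: "\<And>x. 0 < x \<Longrightarrow> x \<le> \<delta> \<Longrightarrow> (\<lambda>n. f n x) sums s x"
    and g: "\<And>x. 0 < x \<Longrightarrow> x \<le> \<delta> \<Longrightarrow> (\<lambda>n. g n x) sums s x"
    and D: "(\<lambda>n. d n m) sums D"
  shows "(\<lambda>n. c n m) sums D"
proof -
  have summ: "summable (\<lambda>n. a n m)" and "(\<lambda>m. (\<Sum>n. a n m) * x ^ m) sums s x"
    if a0: "\<And>n m. a n m \<ge> 0" and x: "0 < x" "x \<le> \<delta>"
      and a: "\<And>n. (\<lambda>m. a n m * x ^ m) sums h n" and h: "h sums s x" for a h x m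
  proof -
    have *: "summable (\<lambda>n. a n m * x ^ m)" for m
      using sums_swap_nonneg(1)[of "\<lambda>n m. a n m * x ^ m", OF _ a h] a0 x by simp
    then show col: "summable (\<lambda>n. a n m)" for m
      using summable_mult2[OF *, of m "1 / x ^ m"] x by simp
    have "(\<lambda>m. \<Sum>n. a n m * x ^ m) sums s x"
      using sums_swap_nonneg(2)[of "\<lambda>n m. a n m * x ^ m", OF _ a h] a0 x by simp
    then show "(\<lambda>m. (\<Sum>n. a n m) * x ^ m) sums s x"
      using suminf_mult2[OF col] by simp
  qed
  note C = this
  have "(\<Sum>n. c n m) = (\<Sum>n. d n m)"
  proof (rule powser_coeffs_unique[OF assms(1)])
    fix x :: real assume x: "0 < x" "x \<le> \<delta>"
    show "(\<lambda>m. (\<Sum>n. c n m) * x ^ m) sums s x"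
      by (rule C(2)[OF nonneg(1) x c[OF x] f[OF x]])
    show "(\<lambda>m. (\<Sum>n. d n m) * x ^ m) sums s x"
      by (rule C(2)[OF nonneg(2) x d[OF x] g[OF x]])
  qed
  moreover have "summable (\<lambda>n. c n m)"
    by (rule C(1)[OF nonneg(1) _ _ c f, of \<delta>]) (use assms(1) in auto)
  ultimately show ?thesis using D by (simp add: sums_iff)
qed

section \<open>The sum formula\<close>

lemma harmonic_product_sums:
  fixes x y :: real
  assumes x: "0 \<le> x" "x \<le> 1/4" and y: "0 \<le> y" "y \<le> 1/4"
  shows "(\<lambda>n. (\<Prod>k=1..n. 1 + y / (real k - x)) / (real (Suc n) * (real (Suc n) - x))) sums
           (\<Sum>N. 1 / ((real (Suc N) - x) * (real (Suc N) - y)))" (is "?lhs sums _")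
    and "summable (\<lambda>N. 1 / ((real (Suc N) - x) * (real (Suc N) - y)))"
proof -
  define P where "P n = (\<Prod>k=1..n. real k + y - x)" for n
  define Q where "Q n N = (\<Prod>k=1..n. real k + real N - x)" for n N
  \<comment> \<open>\<open>D\<close> telescopes in both directions: it is the decrement of \<open>C\<close> in \<open>N\<close> and,
    up to the factor \<open>N + 1 - y\<close>, the decrement of \<open>T\<close> in \<open>n\<close>.\<close>
  define D where "D n N = P n / Q (n + 2) N" for n N
  define T where "T N n = P n / Q (Suc n) N" for N n
  define C where "C n N = P n / (real (Suc n) * Q (Suc n) N)" for n N
  have P_pos: "P n > 0" for n
    unfolding P_def using x y by (intro prod_pos) auto
  have Q_pos: "Q n N > 0" for n N
    unfolding Q_def using x by (intro prod_pos) auto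
  have P_Suc: "P (Suc n) = P n * (real (Suc n) + y - x)" for n by (simp add: P_def)
  have Q_Suc: "Q (Suc n) N = Q n N * (real (Suc n) + real N - x)" for n N by (simp add: Q_def)
  have Q_shift: "Q (Suc n) N = (real (Suc N) - x) * Q n (Suc N)" for n N
  proof (induction n)
    case (Suc n)
    have "Q (Suc (Suc n)) N = (real (Suc N) - x) * (Q n (Suc N) * (real (Suc n) + real (Suc N) - x))"
      unfolding Q_Suc[of "Suc n" N] Suc.IH by (simp add: add_ac)
    then show ?case by (simp only: Q_Suc)
  qed (simp add: Q_def)
  have D_nonneg: "D n N \<ge> 0" for n N
    using P_pos[of n] Q_pos[of "n + 2" N] by (simp add: D_def)
  have T_diff: "T N n - T N (Suc n) = (real (Suc N) - y) * D n N" for n N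
  proof -
    define q r where "q = Q (Suc n) N" and "r = real (Suc (Suc n)) + real N - x"
    have "q > 0" "r > 0" using Q_pos x by (auto simp: q_def r_def)
    then have "P n / q - P n * (real (Suc n) + y - x) / (q * r)
                 = (r - (real (Suc n) + y - x)) * P n / (q * r)"
      by (simp add: field_simps)
    then show ?thesis
      by (simp add: T_def D_def P_Suc Q_Suc[of "Suc n"] q_def r_def algebra_simps)
  qed
  have C_diff: "C n N - C n (Suc N) = D n N" for n N
  proof -
    define q r s where "q = Q (Suc n) N" and "r = real (Suc (Suc n)) + real N - x"
      and "s = real (Suc N) - x"
    have pos: "q > 0" "r > 0" "s > 0" using Q_pos x by (auto simp: q_def r_def s_def)
    have "q * r = s * Q (Suc n) (Suc N)"
      using Q_shift[of "Suc n" N] Q_Suc[of "Suc n" N] by (simp add: q_def r_def s_def)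
    then have Q': "Q (Suc n) (Suc N) = q * r / s" using pos by (simp add: field_simps)
    have rs: "r = s + real (Suc n)" by (simp add: r_def s_def)
    have "P n / (real (Suc n) * q) - P n / (real (Suc n) * (q * r / s)) = P n / (q * r)"
    proof -
      have "p / (w * q) - p / (w * (q * (s + w) / s)) = p / (q * (s + w))" if "w > 0" for p w
        using that pos(1,3) add_pos_pos[OF pos(3) that] by (simp add: divide_simps, simp add: algebra_simps)
      from this[of "real (Suc n)" "P n"] show ?thesis unfolding rs by simp
    qed
    then show ?thesis
      using Q_Suc[of "Suc n" N] by (simp add: C_def D_def Q' q_def r_def)
  qed
  have T_bound: "(T N n)\<^sup>2 * real (Suc n) \<le> (T N 0)\<^sup>2" for N n
  proof (induction n)
    case (Suc n)
    define t u where "t = real (Suc n) + y - x" and "u = real (Suc (Suc n)) + real N - x"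
    have tu: "0 \<le> t" "u > 0" using x y by (auto simp: t_def u_def)
    have "t / u \<le> (real (Suc n) + 1/4) / real (Suc (Suc n))"
    proof -
      have "t * real (Suc (Suc n)) \<le> (real (Suc n) + 1/4 - x) * real (Suc (Suc n))"
        using y by (intro mult_right_mono) (auto simp: t_def)
      also have "\<dots> \<le> (real (Suc n) + 1/4) * (real (Suc (Suc n)) - x)"
      proof -
        have "(K + 1/4) * (K + 1 - x) - (K + 1/4 - x) * (K + 1) = 3/4 * x" for K :: real
          by (simp add: field_simps)
        from this[of "real (Suc n)"] show ?thesis using x by simp
      qed
      also have "\<dots> \<le> (real (Suc n) + 1/4) * u"
        by (intro mult_left_mono) (auto simp: u_def)
      finally show ?thesis using tu by (simp add: field_simps)
    qed
    then have "(t / u)\<^sup>2 \<le> ((real (Suc n) + 1/4) / real (Suc (Suc n)))\<^sup>2"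
      using tu by (intro power_mono) auto
    also have "\<dots> \<le> real (Suc n) / real (Suc (Suc n))"
      by (simp add: power2_eq_square divide_simps) (simp add: algebra_simps)
    finally have ratio: "(t / u)\<^sup>2 * real (Suc (Suc n)) \<le> real (Suc n)"
      by (simp add: field_simps)
    have "T N (Suc n) = T N n * (t / u)"
      using Q_Suc[of "Suc n" N] P_Suc[of n] by (simp add: T_def t_def u_def)
    then have "(T N (Suc n))\<^sup>2 * real (Suc (Suc n)) = (T N n)\<^sup>2 * ((t / u)\<^sup>2 * real (Suc (Suc n)))"
      by (simp only: power_mult_distrib mult.assoc)
    also have "\<dots> \<le> (T N n)\<^sup>2 * real (Suc n)"
      by (intro mult_left_mono ratio) auto
    finally show ?case using Suc.IH by linarith
  qed simp
  have T_lim: "T N \<longlonglongrightarrow> 0" for N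
  proof -
    have "(\<lambda>n. (T N n)\<^sup>2) \<longlonglongrightarrow> 0"
    proof (rule tendsto_sandwich[OF _ _ tendsto_const])
      show "\<forall>\<^sub>F n in sequentially. (T N n)\<^sup>2 \<le> (T N 0)\<^sup>2 * (1 / real (Suc n))"
        using T_bound[of N] by (intro always_eventually) (simp add: field_simps)
      have "(\<lambda>n. (T N 0)\<^sup>2 * (1 / real (Suc n))) \<longlonglongrightarrow> (T N 0)\<^sup>2 * 0"
        by (intro tendsto_mult_left LIMSEQ_Suc[OF lim_1_over_n])
      then show "(\<lambda>n. (T N 0)\<^sup>2 * (1 / real (Suc n))) \<longlonglongrightarrow> 0" by simp
    qed simp
    then show ?thesis by (simp add: power_tendsto_0_iff)
  qed
  have C_lim: "C n \<longlonglongrightarrow> 0" for n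
  proof -
    have "(\<lambda>N. 1 / (real k + real N - x)) \<longlonglongrightarrow> 0" for k
    proof (rule real_tendsto_divide_at_top[OF tendsto_const])
      show "LIM N sequentially. real k + real N - x :> at_top"
        using filterlim_tendsto_add_at_top[OF tendsto_const[of "real k - x"] filterlim_real_sequentially]
        by (simp add: algebra_simps)
    qed
    then have "(\<lambda>N. \<Prod>k=1..Suc n. 1 / (real k + real N - x)) \<longlonglongrightarrow> (\<Prod>k=1..Suc n. 0)"
      by (intro tendsto_prod)
    then have "(\<lambda>N. P n / real (Suc n) * (1 / Q (Suc n) N)) \<longlonglongrightarrow> P n / real (Suc n) * 0"
      by (intro tendsto_mult_left) (simp add: Q_def prod_dividef)
    then show ?thesis by (simp add: C_def[abs_def])
  qed
  have rows: "(\<lambda>n. D n N) sums (1 / ((real (Suc N) - x) * (real (Suc N) - y)))" for N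
  proof -
    have "(\<lambda>n. T N n - T N (Suc n)) sums (T N 0 - 0)"
      by (rule telescope_sums'[OF T_lim])
    from sums_mult[OF this, of "1 / (real (Suc N) - y)"] show ?thesis
      using x y by (simp add: T_diff) (simp add: T_def P_def Q_def mult.commute add.commute)
  qed
  have cols: "(\<lambda>N. D n N) sums C n 0" for n
    using telescope_sums'[OF C_lim[of n]] by (simp add: C_diff)
  show summ: "summable (\<lambda>N. 1 / ((real (Suc N) - x) * (real (Suc N) - y)))"
  proof (rule summable_comparison_test')
    show "summable (\<lambda>N. 2 * inverse (real (Suc N) ^ 2))"
      by (intro summable_mult summable_Suc_iff[THEN iffD2] inverse_power_summable) simp
    show "norm (1 / ((real (Suc N) - x) * (real (Suc N) - y))) \<le> 2 * inverse (real (Suc N) ^ 2)"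
      if "N \<ge> 0" for N
    proof -
      have "real (Suc N) * (3/4) * (real (Suc N) * (3/4)) \<le> (real (Suc N) - x) * (real (Suc N) - y)"
        using x y by (intro mult_mono) auto
      moreover have "real (Suc N) ^ 2 / 2 \<le> real (Suc N) * (3/4) * (real (Suc N) * (3/4))"
      proof -
        have "w ^ 2 / 2 \<le> w * (3/4) * (w * (3/4))" for w :: real
          using zero_le_square[of w] by (simp add: power2_eq_square)
        then show ?thesis .
      qed
      ultimately have "real (Suc N) ^ 2 / 2 \<le> (real (Suc N) - x) * (real (Suc N) - y)"
        by linarith
      moreover have "0 < real (Suc N) ^ 2 / 2" by simp
      ultimately have "1 / ((real (Suc N) - x) * (real (Suc N) - y)) \<le> 1 / (real (Suc N) ^ 2 / 2)"
        by (intro divide_left_mono mult_pos_pos) (use x y in auto)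
      moreover have "0 \<le> 1 / ((real (Suc N) - x) * (real (Suc N) - y))"
        using x y by (intro divide_nonneg_nonneg mult_nonneg_nonneg) auto
      ultimately show ?thesis by (simp only: real_norm_def abs_of_nonneg) (simp add: inverse_eq_divide)
    qed
  qed
  have "?lhs = (\<lambda>n. \<Sum>N. D n N)"
  proof
    fix n
    have "(\<Prod>k=1..n. 1 + y / (real k - x)) = P n / Q n 0"
      unfolding P_def Q_def prod_dividef[symmetric]
      by (rule prod.cong) (use x in \<open>auto simp: field_simps\<close>)
    then show "?lhs n = (\<Sum>N. D n N)"
      using sums_unique[OF cols[of n]] Q_Suc[of n 0] by (simp add: C_def mult_ac)
  qed
  with sums_swap_nonneg(2)[of "\<lambda>N n. D n N", OF D_nonneg rows summable_sums[OF summ]]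
  show "?lhs sums (\<Sum>N. 1 / ((real (Suc N) - x) * (real (Suc N) - y)))" by simp
qed

text \<open>The power series of \<open>1 / (k - X)\<close>.\<close>

definition recip_fps :: "nat \<Rightarrow> real fps" where
  "recip_fps k = Abs_fps (\<lambda>m. 1 / real k ^ Suc m)"

lemma fps_mult_nonneg_sums:
  fixes F G :: "real fps"
  assumes "\<And>m. F $ m \<ge> 0" "\<And>m. G $ m \<ge> 0" "x \<ge> 0"
    and F: "(\<lambda>m. F $ m * x ^ m) sums a" and G: "(\<lambda>m. G $ m * x ^ m) sums b"
  shows "(\<lambda>m. (F * G) $ m * x ^ m) sums (a * b)"
proof -
  have "(\<lambda>m. \<Sum>i\<le>m. F $ i * x ^ i * (G $ (m - i) * x ^ (m - i))) sums (a * b)"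
    using Cauchy_product_sums[of "\<lambda>m. F $ m * x ^ m" "\<lambda>m. G $ m * x ^ m"] assms
    by (simp add: sums_iff)
  also have "(\<lambda>m. \<Sum>i\<le>m. F $ i * x ^ i * (G $ (m - i) * x ^ (m - i))) = (\<lambda>m. (F * G) $ m * x ^ m)"
  proof
    fix m
    have "F $ i * x ^ i * (G $ (m - i) * x ^ (m - i)) = F $ i * G $ (m - i) * x ^ m" if "i \<le> m" for i
      using that by (simp add: power_add[symmetric] mult_ac)
    then show "(\<Sum>i\<le>m. F $ i * x ^ i * (G $ (m - i) * x ^ (m - i))) = (F * G) $ m * x ^ m"
      by (auto simp: fps_mult_nth sum_distrib_right atLeast0AtMost intro!: sum.cong)
  qed
  finally show ?thesis .
qed

lemma fps_mult_nth_nonneg: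
  fixes F G :: "real fps"
  assumes "\<And>m. F $ m \<ge> 0" "\<And>m. G $ m \<ge> 0"
  shows "(F * G) $ m \<ge> 0"
  using assms by (auto simp: fps_mult_nth intro!: sum_nonneg)

lemma recip_fps_nonneg: "recip_fps k $ m \<ge> 0"
  by (simp add: recip_fps_def)

lemma prod_recip_fps_nonneg: "(\<Prod>k\<in>A. recip_fps (f k)) $ m \<ge> 0"
proof (induction A arbitrary: m rule: infinite_finite_induct)
  case (insert k A)
  then show ?case by (simp add: fps_mult_nth_nonneg recip_fps_nonneg)
qed auto

lemma recip_fps_sums:
  assumes "k \<ge> 1" "0 \<le> x" "x < 1"
  shows "(\<lambda>m. recip_fps k $ m * x ^ m) sums (1 / (real k - x))"
proof -
  have "(\<lambda>m. 1 / real k * (x / real k) ^ m) sums (1 / real k * (1 / (1 - x / real k)))"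
    using assms by (intro sums_mult geometric_sums) auto
  also have "1 / real k * (1 / (1 - x / real k)) = 1 / (real k - x)"
    using assms by (simp add: field_simps)
  finally show ?thesis by (simp add: recip_fps_def power_divide)
qed

lemma prod_recip_fps_sums:
  assumes "finite A" "0 \<notin> A" "0 \<le> x" "x < 1"
  shows "(\<lambda>m. (\<Prod>k\<in>A. recip_fps k) $ m * x ^ m) sums (\<Prod>k\<in>A. 1 / (real k - x))"
  using assms(1,2)
proof (induction A)
  case empty
  show ?case using sums_single[of 0 "\<lambda>_. 1 :: real"] by (simp add: if_distrib if_distribR cong: if_cong)
next
  case (insert k A)
  then have "(\<lambda>m. (recip_fps k * (\<Prod>k\<in>A. recip_fps k)) $ m * x ^ m) sums
               (1 / (real k - x) * (\<Prod>k\<in>A. 1 / (real k - x)))"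
    using assms(3,4)
    by (intro fps_mult_nonneg_sums recip_fps_sums)
      (auto simp: prod_recip_fps_nonneg recip_fps_nonneg Suc_le_eq)
  then show ?case using insert by simp
qed

lemma elementary_symmetric_sums:
  fixes x :: real
  assumes x: "0 \<le> x" "x \<le> 1/4"
  shows "(\<lambda>n. (\<Sum>A | A \<subseteq> {1..n} \<and> card A = r. \<Prod>k\<in>A. 1 / (real k - x))
                / (real (Suc n) * (real (Suc n) - x))) sums
           (\<Sum>N. 1 / (real (Suc N) ^ Suc r * (real (Suc N) - x)))"
    and "summable (\<lambda>N. 1 / (real (Suc N) ^ Suc r * (real (Suc N) - x)))"
proof -
  define e where "e n r = (\<Sum>A | A \<subseteq> {1..n} \<and> card A = r. \<Prod>k\<in>A. 1 / (real k - x))" for n r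
  show summ: "summable (\<lambda>N. 1 / (real (Suc N) ^ Suc r * (real (Suc N) - x)))"
  proof (rule summable_comparison_test')
    show "summable (\<lambda>N. 1 / ((real (Suc N) - x) * (real (Suc N) - 0)))"
      by (rule harmonic_product_sums(2)) (use x in auto)
    show "norm (1 / (real (Suc N) ^ Suc r * (real (Suc N) - x)))
            \<le> 1 / ((real (Suc N) - x) * (real (Suc N) - 0))" if "N \<ge> 0" for N
    proof -
      have "real (Suc N) ^ 1 \<le> real (Suc N) ^ Suc r" by (intro power_increasing) auto
      then have "(real (Suc N) - x) * real (Suc N) \<le> real (Suc N) ^ Suc r * (real (Suc N) - x)"
        using x by (subst mult.commute) (intro mult_right_mono, auto)
      then have "1 / (real (Suc N) ^ Suc r * (real (Suc N) - x)) \<le> 1 / ((real (Suc N) - x) * real (Suc N))"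
        using x by (intro divide_left_mono) auto
      then show ?thesis using x by simp
    qed
  qed
  have e_nonneg: "e n r \<ge> 0" for n r
    unfolding e_def using x by (intro sum_nonneg prod_nonneg) auto
  have expand: "(\<Prod>k=1..n. 1 + y / (real k - x)) = (\<Sum>r\<le>n. e n r * y ^ r)" for n y
  proof -
    have "(\<Prod>k=1..n. 1 + y / (real k - x)) = (\<Sum>A\<in>Pow {1..n}. \<Prod>k\<in>A. y / (real k - x))"
      by (subst add.commute, subst prod_add) auto
    also have "\<dots> = (\<Sum>r\<le>n. \<Sum>A | A \<in> Pow {1..n} \<and> card A = r. \<Prod>k\<in>A. y / (real k - x))"
    proof (rule sum.group[symmetric])
      show "card ` Pow {1..n} \<subseteq> {..n}" using card_mono[of "{1..n}"] by fastforce
    qed auto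
    also have "\<dots> = (\<Sum>r\<le>n. e n r * y ^ r)"
    proof (rule sum.cong)
      fix r
      show "(\<Sum>A | A \<in> Pow {1..n} \<and> card A = r. \<Prod>k\<in>A. y / (real k - x)) = e n r * y ^ r"
        unfolding e_def sum_distrib_right Pow_iff
        by (rule sum.cong) (auto simp: prod_dividef)
    qed simp
    finally show ?thesis .
  qed
  have "(\<lambda>n. e n r / (real (Suc n) * (real (Suc n) - x))) sums
          (\<Sum>N. 1 / (real (Suc N) ^ Suc r * (real (Suc N) - x)))"
  proof (rule sums_powser_coeffs_transfer[where \<delta> = "1/4"
        and f = "\<lambda>n y. (\<Prod>k=1..n. 1 + y / (real k - x)) / (real (Suc n) * (real (Suc n) - x))"
        and g = "\<lambda>N y. 1 / ((real (Suc N) - x) * (real (Suc N) - y))"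
        and s = "\<lambda>y. \<Sum>N. 1 / ((real (Suc N) - x) * (real (Suc N) - y))"
        and d = "\<lambda>N r. 1 / (real (Suc N) ^ Suc r * (real (Suc N) - x))"
        and c = "\<lambda>n r. e n r / (real (Suc n) * (real (Suc n) - x))"])
    fix n and y :: real assume y: "0 < y" "y \<le> 1/4"
    have "(\<lambda>r. e n r / (real (Suc n) * (real (Suc n) - x)) * y ^ r) sums
            (\<Sum>r\<le>n. e n r / (real (Suc n) * (real (Suc n) - x)) * y ^ r)"
    proof (rule sums_finite)
      fix r assume "r \<notin> {..n}"
      then have none: "{A. A \<subseteq> {1..n} \<and> card A = r} = {}"
        using card_mono[of "{1..n}"] by fastforce
      show "e n r / (real (Suc n) * (real (Suc n) - x)) * y ^ r = 0"
        unfolding e_def none by simp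
    qed simp
    then show "(\<lambda>r. e n r / (real (Suc n) * (real (Suc n) - x)) * y ^ r) sums
            ((\<Prod>k=1..n. 1 + y / (real k - x)) / (real (Suc n) * (real (Suc n) - x)))"
      unfolding expand by (simp add: sum_divide_distrib)
    have "(\<lambda>r. 1 / (real (Suc n) - x) * (recip_fps (Suc n) $ r * y ^ r)) sums
            (1 / (real (Suc n) - x) * (1 / (real (Suc n) - y)))"
      using y by (intro sums_mult recip_fps_sums) auto
    then show "(\<lambda>r. 1 / (real (Suc n) ^ Suc r * (real (Suc n) - x)) * y ^ r) sums
            (1 / ((real (Suc n) - x) * (real (Suc n) - y)))"
      by (simp add: recip_fps_def mult_ac)
  qed (use x e_nonneg summ harmonic_product_sums in \<open>auto intro!: summable_sums\<close>)
  then show "(\<lambda>n. (\<Sum>A | A \<subseteq> {1..n} \<and> card A = r. \<Prod>k\<in>A. 1 / (real k - x))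
                / (real (Suc n) * (real (Suc n) - x))) sums
           (\<Sum>N. 1 / (real (Suc N) ^ Suc r * (real (Suc N) - x)))"
    by (simp add: e_def)
qed

lemma summable_inverse_Suc_power: "s \<ge> 2 \<Longrightarrow> summable (\<lambda>N. 1 / real (Suc N) ^ s)"
  using summable_Suc_iff[THEN iffD2, OF inverse_power_summable[of s, where 'a = real]]
  by (simp add: field_simps)

lemma sum_formula:
  "(\<lambda>n. (recip_fps (Suc n) * (\<Sum>A | A \<subseteq> {1..n} \<and> card A = r. \<Prod>k\<in>A. recip_fps k)) $ m
          / real (Suc n)) sums (\<Sum>N. 1 / real (Suc N) ^ (m + r + 2))"
proof (rule sums_powser_coeffs_transfer[where \<delta> = "1/4"
      and c = "\<lambda>n m. (recip_fps (Suc n) * (\<Sum>A | A \<subseteq> {1..n} \<and> card A = r. \<Prod>k\<in>A. recip_fps k)) $ m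
          / real (Suc n)"
      and d = "\<lambda>N m. 1 / real (Suc N) ^ (m + r + 2)"
      and f = "\<lambda>n x. (\<Sum>A | A \<subseteq> {1..n} \<and> card A = r. \<Prod>k\<in>A. 1 / (real k - x))
                / (real (Suc n) * (real (Suc n) - x))"
      and g = "\<lambda>N x. 1 / (real (Suc N) ^ Suc r * (real (Suc N) - x))"
      and s = "\<lambda>x. \<Sum>N. 1 / (real (Suc N) ^ Suc r * (real (Suc N) - x))"])
  show nonneg: "(recip_fps (Suc n) * (\<Sum>A | A \<subseteq> {1..n} \<and> card A = r. \<Prod>k\<in>A. recip_fps k)) $ m
          / real (Suc n) \<ge> 0" for n m
    by (intro divide_nonneg_nonneg fps_mult_nth_nonneg)
      (auto simp: fps_sum_nth recip_fps_nonneg intro!: sum_nonneg prod_recip_fps_nonneg)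
  fix n and x :: real assume x: "0 < x" "x \<le> 1/4"
  have "(\<lambda>m. 1 / real (Suc n) * ((recip_fps (Suc n)
             * (\<Sum>A | A \<subseteq> {1..n} \<and> card A = r. \<Prod>k\<in>A. recip_fps k)) $ m * x ^ m)) sums
          (1 / real (Suc n) * (1 / (real (Suc n) - x)
             * (\<Sum>A | A \<subseteq> {1..n} \<and> card A = r. \<Prod>k\<in>A. 1 / (real k - x))))"
  proof (intro sums_mult fps_mult_nonneg_sums recip_fps_sums)
    have "(\<lambda>m. \<Sum>A | A \<subseteq> {1..n} \<and> card A = r. (\<Prod>k\<in>A. recip_fps k) $ m * x ^ m) sums
       (\<Sum>A | A \<subseteq> {1..n} \<and> card A = r. \<Prod>k\<in>A. 1 / (real k - x))"
      by (intro sums_sum prod_recip_fps_sums)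
        (use x in \<open>auto intro: finite_subset\<close>)
    then show "(\<lambda>m. (\<Sum>A | A \<subseteq> {1..n} \<and> card A = r. \<Prod>k\<in>A. recip_fps k) $ m * x ^ m) sums
       (\<Sum>A | A \<subseteq> {1..n} \<and> card A = r. \<Prod>k\<in>A. 1 / (real k - x))"
      by (simp add: fps_sum_nth sum_distrib_right)
  qed (use x in \<open>auto simp: fps_sum_nth recip_fps_nonneg intro!: sum_nonneg prod_recip_fps_nonneg\<close>)
  then show "(\<lambda>m. (recip_fps (Suc n) * (\<Sum>A | A \<subseteq> {1..n} \<and> card A = r. \<Prod>k\<in>A. recip_fps k)) $ m
          / real (Suc n) * x ^ m) sums
     ((\<Sum>A | A \<subseteq> {1..n} \<and> card A = r. \<Prod>k\<in>A. 1 / (real k - x))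
                / (real (Suc n) * (real (Suc n) - x)))"
    by simp
  have "(\<lambda>m. 1 / real (Suc n) ^ Suc r * (recip_fps (Suc n) $ m * x ^ m)) sums
          (1 / real (Suc n) ^ Suc r * (1 / (real (Suc n) - x)))"
    using x by (intro sums_mult recip_fps_sums) auto
  then show "(\<lambda>m. 1 / real (Suc n) ^ (m + r + 2) * x ^ m) sums
      (1 / (real (Suc n) ^ Suc r * (real (Suc n) - x)))"
    by (simp add: recip_fps_def power_add mult_ac)
qed ((simp; fail) | (rule elementary_symmetric_sums(1) summable_sums[OF elementary_symmetric_sums(2)]
        summable_sums[OF summable_inverse_Suc_power]; simp))+

section \<open>Sums over compositions and increasing tuples\<close>

lemma finite_compositions: "finite (compositions p n)"
proof (rule finite_subset)
  show "compositions p n \<subseteq> {1..p} \<rightarrow>\<^sub>E {..n}"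
  proof
    fix \<alpha> assume "\<alpha> \<in> compositions p n"
    then have \<alpha>: "\<alpha> \<in> {1..p} \<rightarrow>\<^sub>E {1..}" "(\<Sum>i=1..p. \<alpha> i) = n"
      by (auto simp: compositions_def)
    have "\<alpha> i \<le> n" if "i \<in> {1..p}" for i
      using member_le_sum[of i "{1..p}" \<alpha>] that \<alpha>(2) by simp
    with \<alpha>(1) show "\<alpha> \<in> {1..p} \<rightarrow>\<^sub>E {..n}" by (auto simp: PiE_iff)
  qed
qed (simp add: finite_PiE)

lemma sum_compositions_eq_fps_nth:
  fixes w :: "nat \<Rightarrow> 'a :: comm_ring_1"
  shows "(\<Sum>\<alpha>\<in>compositions p n. \<Prod>i=1..p. w i ^ \<alpha> i)
           = (\<Prod>i=1..p. Abs_fps (\<lambda>n. if n = 0 then 0 else w i ^ n)) $ n"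
proof (induction p arbitrary: n)
  case 0
  have "compositions 0 n = (if n = 0 then {\<lambda>_. undefined} else {})"
    by (auto simp: compositions_def)
  then show ?case by simp
next
  case (Suc p)
  define G where "G i = Abs_fps (\<lambda>n. if n = 0 then 0 else w i ^ n)" for i
  have "(\<Prod>i=1..Suc p. G i) $ n = (\<Sum>a=0..n. (\<Prod>i=1..p. G i) $ a * G (Suc p) $ (n - a))"
    by (simp add: fps_mult_nth)
  also have "\<dots> = (\<Sum>a<n. (\<Prod>i=1..p. G i) $ a * w (Suc p) ^ (n - a))"
    by (rule sum.mono_neutral_cong_right) (auto simp: G_def)
  also have "\<dots> = (\<Sum>a<n. \<Sum>\<alpha>\<in>compositions p a. (\<Prod>i=1..p. w i ^ \<alpha> i) * w (Suc p) ^ (n - a))"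
    by (simp only: sum_distrib_right[symmetric] Suc.IH G_def)
  also have "\<dots> = (\<Sum>z\<in>Sigma {..<n} (compositions p). (\<Prod>i=1..p. w i ^ snd z i) * w (Suc p) ^ (n - fst z))"
    by (subst sum.Sigma) (auto simp: finite_compositions case_prod_unfold)
  also have "\<dots> = (\<Sum>\<beta>\<in>compositions (Suc p) n. \<Prod>i=1..Suc p. w i ^ \<beta> i)"
  proof (rule sum.reindex_bij_witness[where j = "\<lambda>z. (snd z)(Suc p := n - fst z)"
        and i = "\<lambda>\<beta>. (n - \<beta> (Suc p), \<beta>(Suc p := undefined))"])
    fix z assume "z \<in> Sigma {..<n} (compositions p)"
    then have "fst z < n" "snd z \<in> compositions p (fst z)" by auto
    then have z: "fst z < n" "snd z \<in> {1..p} \<rightarrow>\<^sub>E {1..}" "(\<Sum>i=1..p. snd z i) = fst z"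
      by (simp_all only: compositions_def mem_Collect_eq)
    have "snd z (Suc p) = undefined" using z(2) by (auto simp: PiE_iff extensional_def)
    then have "(snd z)(Suc p := undefined) = snd z" by (metis fun_upd_triv)
    then show "(n - ((snd z)(Suc p := n - fst z)) (Suc p), ((snd z)(Suc p := n - fst z))(Suc p := undefined)) = z"
      using z(1) by (simp add: prod_eq_iff)
    have "(\<Sum>i=1..p. ((snd z)(Suc p := n - fst z)) i) = fst z"
      unfolding z(3)[symmetric] by (rule sum.cong) auto
    then show "(snd z)(Suc p := n - fst z) \<in> compositions (Suc p) n"
      using z(1,2) by (auto simp: compositions_def PiE_iff extensional_def le_Suc_eq)
    show "(\<Prod>i=1..Suc p. w i ^ ((snd z)(Suc p := n - fst z)) i)
        = (\<Prod>i=1..p. w i ^ snd z i) * w (Suc p) ^ (n - fst z)"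
      by (auto intro!: prod.cong)
  next
    fix \<beta> assume "\<beta> \<in> compositions (Suc p) n"
    then have \<beta>: "\<beta> \<in> {1..Suc p} \<rightarrow>\<^sub>E {1..}" "(\<Sum>i=1..p. \<beta> i) + \<beta> (Suc p) = n"
      by (auto simp: compositions_def)
    have pos: "\<beta> (Suc p) \<ge> 1" using \<beta>(1) by (auto simp: PiE_iff)
    show "(snd (n - \<beta> (Suc p), \<beta>(Suc p := undefined)))
        (Suc p := n - fst (n - \<beta> (Suc p), \<beta>(Suc p := undefined))) = \<beta>"
      using \<beta>(2) by (auto simp: fun_eq_iff)
    have "(\<Sum>i=1..p. (\<beta>(Suc p := undefined)) i) = (\<Sum>i=1..p. \<beta> i)"
      by (rule sum.cong) auto
    then have "\<beta>(Suc p := undefined) \<in> compositions p (n - \<beta> (Suc p))"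
      using \<beta> by (auto simp: compositions_def PiE_iff extensional_def)
    then show "(n - \<beta> (Suc p), \<beta>(Suc p := undefined)) \<in> Sigma {..<n} (compositions p)"
      using \<beta>(2) pos by simp
  qed
  finally show ?case by (simp add: G_def)
qed

lemma sum_compositions_eq_recip_fps:
  "(\<Sum>\<alpha>\<in>compositions p (m + p). \<Prod>i=1..p. (1 / real (k i)) ^ \<alpha> i)
     = (\<Prod>i=1..p. recip_fps (k i)) $ m"
proof -
  have "Abs_fps (\<lambda>n. if n = 0 then 0 else (1 / real (k i)) ^ n) = fps_X * recip_fps (k i)" for i
    by (rule fps_ext) (auto simp: recip_fps_def power_divide gr0_conv_Suc)
  then show ?thesis
    unfolding sum_compositions_eq_fps_nth by (simp add: prod.distrib fps_X_power_mult_nth)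
qed

lemma bij_betw_increasing_tuples:
  assumes "j < p"
  shows "bij_betw (\<lambda>k. (k p - 1, k ` {j+1..<p})) (increasing_tuples j p)
           (SIGMA n:UNIV. {A. A \<subseteq> {1..n} \<and> card A = p - j - 1})"
  unfolding bij_betw_def
proof
  have sorted_map: "sorted (map k [j+1..<p])" "distinct (map k [j+1..<p])"
    if "k \<in> increasing_tuples j p" for k
  proof -
    have "sorted_wrt (<) (map k [j+1..<p])"
      unfolding sorted_wrt_map
      by (rule sorted_wrt_mono_rel[OF _ sorted_wrt_upt])
        (use that in \<open>auto simp: increasing_tuples_def strict_mono_on_def\<close>)
    then show "sorted (map k [j+1..<p])" "distinct (map k [j+1..<p])"
      by (simp_all only: strict_sorted_iff)
  qed
  show "inj_on (\<lambda>k. (k p - 1, k ` {j+1..<p})) (increasing_tuples j p)"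
  proof (rule inj_onI)
    fix k l assume k: "k \<in> increasing_tuples j p" and l: "l \<in> increasing_tuples j p"
      and eq: "(k p - 1, k ` {j+1..<p}) = (l p - 1, l ` {j+1..<p})"
    have "map k [j+1..<p] = map l [j+1..<p]"
      by (rule sorted_distinct_set_unique) (use sorted_map[OF k] sorted_map[OF l] eq in auto)
    then have "k i = l i" if "i \<in> {j+1..<p}" for i using that by (simp add: map_eq_conv)
    note less_p = this
    have "k p \<ge> 1" "l p \<ge> 1" using k l assms by (auto simp: increasing_tuples_def PiE_iff)
    moreover have "k p - 1 = l p - 1" using eq by simp
    ultimately have kl: "k p = l p" by linarith
    have "k i = l i" if "i \<in> {j+1..p}" for i using that less_p[of i] kl by (cases "i = p") auto
    then show "k = l"
      using k l by (intro PiE_ext[of k "{j+1..p}" "\<lambda>_. {1..}" l])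
        (auto simp: increasing_tuples_def)
  qed
  show "(\<lambda>k. (k p - 1, k ` {j+1..<p})) ` increasing_tuples j p
          = (SIGMA n:UNIV. {A. A \<subseteq> {1..n} \<and> card A = p - j - 1})"
  proof (intro equalityI subsetI)
    fix z assume "z \<in> (\<lambda>k. (k p - 1, k ` {j+1..<p})) ` increasing_tuples j p"
    then obtain k where k: "k \<in> increasing_tuples j p" and z: "z = (k p - 1, k ` {j+1..<p})" by auto
    have "card (k ` {j+1..<p}) = card {j+1..<p}"
      using sorted_map(2)[OF k] by (intro card_image) (simp add: distinct_map)
    moreover have "k i \<in> {1..k p - 1}" if "i \<in> {j+1..<p}" for i
    proof -
      have "k i < k p" "k i \<ge> 1"
        using k that assms by (auto simp: increasing_tuples_def PiE_iff strict_mono_on_def)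
      then show ?thesis by auto
    qed
    ultimately show "z \<in> (SIGMA n:UNIV. {A. A \<subseteq> {1..n} \<and> card A = p - j - 1})"
      by (auto simp: z)
  next
    fix z :: "nat \<times> nat set" assume "z \<in> (SIGMA n:UNIV. {A. A \<subseteq> {1..n} \<and> card A = p - j - 1})"
    then obtain n A where z: "z = (n, A)" and A: "A \<subseteq> {1..n}" "card A = p - j - 1" by auto
    have "finite A" using finite_subset[OF A(1)] by simp
    define xs where "xs = sorted_list_of_set A @ [Suc n]"
    have len: "length (sorted_list_of_set A) = p - j - 1" using A(2) by simp
    have sorted: "sorted_wrt (<) xs"
      using A(1) \<open>finite A\<close> by (auto simp: xs_def sorted_wrt_append less_Suc_eq_le)
    define k where "k = (\<lambda>i\<in>{j+1..p}. xs ! (i - j - 1))"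
    have xs_pos: "set xs \<subseteq> {1..}" using A(1) \<open>finite A\<close> by (auto simp: xs_def)
    have "length xs = p - j" using assms len by (simp add: xs_def)
    have range: "k i \<ge> 1" if "i \<in> {j+1..p}" for i
    proof -
      have "i - j - 1 < length xs" using that \<open>length xs = p - j\<close> by auto
      then have "xs ! (i - j - 1) \<in> {1..}" using xs_pos nth_mem by blast
      then show ?thesis using that by (simp add: k_def)
    qed
    have "k a < k b" if "a \<in> {j+1..p}" "b \<in> {j+1..p}" "a < b" for a b
      using that sorted_wrt_nth_less[OF sorted, of "a - j - 1" "b - j - 1"] \<open>length xs = p - j\<close>
      by (simp add: k_def)
    with range have "k \<in> increasing_tuples j p"
      by (auto simp: increasing_tuples_def strict_mono_on_def PiE_iff k_def)
    moreover have "k p = Suc n"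
      using assms len by (simp add: k_def xs_def nth_append)
    moreover have "k ` {j+1..<p} = A"
    proof -
      have "k ` {j+1..<p} = (\<lambda>i. sorted_list_of_set A ! (i - j - 1)) ` {j+1..<p}"
        by (rule image_cong) (use len in \<open>auto simp: k_def xs_def nth_append\<close>)
      also have "\<dots> = (!) (sorted_list_of_set A) ` (\<lambda>i. i - j - 1) ` {j+1..<p}"
        by (simp add: image_image)
      also have "(\<lambda>i. i - j - 1) ` {j+1..<p} = {..<p - j - 1}"
      proof (intro equalityI subsetI)
        fix i assume "i \<in> {..<p - j - 1}"
        then show "i \<in> (\<lambda>i. i - j - 1) ` {j+1..<p}"
          by (intro image_eqI[of _ _ "i + j + 1"]) auto
      qed auto
      also have "(!) (sorted_list_of_set A) ` {..<p - j - 1} = set (sorted_list_of_set A)"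
        using len by (auto simp: set_conv_nth)
      finally show ?thesis using \<open>finite A\<close> by simp
    qed
    ultimately show "z \<in> (\<lambda>k. (k p - 1, k ` {j+1..<p})) ` increasing_tuples j p"
      by (intro image_eqI[of _ _ k]) (simp_all add: z)
  qed
qed

definition zeta_fps :: "nat \<Rightarrow> real fps" where
  "zeta_fps r = Abs_fps (\<lambda>m. \<Sum>N. 1 / real (Suc N) ^ (m + r + 1))"

lemma increasing_tuples_has_sum:
  assumes "j < p"
  shows "((\<lambda>k. (\<Prod>i=j+1..p. recip_fps (k i)) $ m / real (k p)) has_sum zeta_fps (p - j) $ m)
           (increasing_tuples j p)"
proof -
  define r where "r = p - j - 1"
  define B where "B n = {A. A \<subseteq> {1..n} \<and> card A = r}" for n :: nat
  define h where "h = (\<lambda>(n, A). (recip_fps (Suc n) * (\<Prod>a\<in>A. recip_fps a)) $ m / real (Suc n))"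
  define g where "g n = (recip_fps (Suc n) * (\<Sum>A\<in>B n. \<Prod>a\<in>A. recip_fps a)) $ m / real (Suc n)" for n
  have "zeta_fps (p - j) $ m = (\<Sum>N. 1 / real (Suc N) ^ (m + r + 2))"
  proof -
    have "m + (p - j) + 1 = m + r + 2" using assms by (simp add: r_def)
    then show ?thesis by (simp only: zeta_fps_def fps_nth_Abs_fps)
  qed
  then have "g sums (zeta_fps (p - j) $ m)"
    using sum_formula[of r m] by (simp add: g_def[abs_def] B_def)
  moreover have h_nonneg: "h (n, A) \<ge> 0" for n A
    by (simp add: h_def fps_mult_nth_nonneg recip_fps_nonneg prod_recip_fps_nonneg)
  have finite_B: "finite (B n)" for n by (simp add: B_def)
  have inner: "((\<lambda>A. h (n, A)) has_sum g n) (B n)" for n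
    by (rule has_sum_finiteI[OF finite_B])
      (simp add: h_def g_def sum_distrib_left fps_sum_nth sum_divide_distrib)
  have "g n \<ge> 0" for n
    using inner h_nonneg by (rule has_sum_nonneg)
  ultimately have outer: "(g has_sum zeta_fps (p - j) $ m) UNIV"
    by (intro sums_nonneg_imp_has_sum)
  have "h summable_on (SIGMA n:UNIV. B n)"
    by (rule summable_on_SigmaI[where g = g]) (use inner outer h_nonneg in \<open>auto simp: summable_on_def\<close>)
  then have "(h has_sum zeta_fps (p - j) $ m) (SIGMA n:UNIV. B n)"
    by (intro has_sum_SigmaI[OF inner outer])
  then have "((\<lambda>k. h (k p - 1, k ` {j+1..<p})) has_sum zeta_fps (p - j) $ m) (increasing_tuples j p)"
    using has_sum_reindex_bij_betw[OF bij_betw_increasing_tuples[OF assms], of h]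
    by (simp add: B_def r_def)
  moreover have "h (k p - 1, k ` {j+1..<p}) = (\<Prod>i=j+1..p. recip_fps (k i)) $ m / real (k p)"
    if k: "k \<in> increasing_tuples j p" for k
  proof -
    have "k p \<ge> 1" using k assms by (auto simp: increasing_tuples_def PiE_iff)
    have "inj_on k {j+1..<p}"
      using k unfolding increasing_tuples_def
      by (auto intro: inj_on_subset[OF strict_mono_on_imp_inj_on])
    then have "(\<Prod>a\<in>k ` {j+1..<p}. recip_fps a) = (\<Prod>i=j+1..<p. recip_fps (k i))"
      by (simp add: prod.reindex)
    moreover have "{j+1..p} = insert p {j+1..<p}" using assms by auto
    ultimately show ?thesis using \<open>k p \<ge> 1\<close> by (simp add: h_def)
  qed
  ultimately show ?thesis by (subst has_sum_cong) (auto simp: eq_commute)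
qed

lemma has_sum_sum:
  fixes f :: "'i \<Rightarrow> 'a \<Rightarrow> 'b :: topological_comm_monoid_add"
  assumes "\<And>i. i \<in> I \<Longrightarrow> (f i has_sum s i) A"
  shows "((\<lambda>x. \<Sum>i\<in>I. f i x) has_sum (\<Sum>i\<in>I. s i)) A"
  using assms by (induction I rule: infinite_finite_induct) (auto intro!: has_sum_add)

lemma S_eq_fps_nth:
  assumes "j < p"
  shows "S m p j = (recip_fps 1 ^ j * zeta_fps (p - j)) $ m"
proof -
  define t where "t \<alpha> k = 1 powi (- (\<Sum>i=1..j. int (\<alpha> i)))
          * (\<Prod>i=j+1..p-1. real (k i) powi (- int (\<alpha> i)))
          * real (k p) powi (- int (\<alpha> p) - 1)" for \<alpha> k :: "nat \<Rightarrow> nat"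
  have t_eq: "t \<alpha> k = (\<Prod>i=1..p. (1 / real (if i \<le> j then 1 else k i)) ^ \<alpha> i) / real (k p)"
    if "k p \<ge> 1" for \<alpha> k
  proof -
    have "{1..p} = {1..j} \<union> ({j+1..p-1} \<union> {p})" using assms by auto
    then have "(\<Prod>i=1..p. (1 / real (if i \<le> j then 1 else k i)) ^ \<alpha> i)
        = (\<Prod>i=1..j. (1 / real (if i \<le> j then 1 else k i)) ^ \<alpha> i)
          * ((\<Prod>i=j+1..p-1. (1 / real (if i \<le> j then 1 else k i)) ^ \<alpha> i)
          * (1 / real (if p \<le> j then 1 else k p)) ^ \<alpha> p)"
      using assms by (simp only:) (subst prod.union_disjoint; force)+
    also have "\<dots> = (\<Prod>i=j+1..p-1. (1 / real (k i)) ^ \<alpha> i) * (1 / real (k p)) ^ \<alpha> p"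
      using assms by simp
    also have "(\<Prod>i=j+1..p-1. (1 / real (k i)) ^ \<alpha> i) = (\<Prod>i=j+1..p-1. real (k i) powi (- int (\<alpha> i)))"
      by (simp add: power_int_minus inverse_eq_divide power_divide)
    moreover have "real (k p) powi (- int (\<alpha> p) - 1) = (1 / real (k p)) ^ \<alpha> p / real (k p)"
    proof -
      have "- int (\<alpha> p) - 1 = - int (Suc (\<alpha> p))" by simp
      then show ?thesis
        by (simp only: power_int_minus power_int_of_nat) (simp add: power_divide inverse_eq_divide)
    qed
    ultimately show ?thesis by (simp add: t_def)
  qed
  have tail: "k p \<ge> 1" if "k \<in> increasing_tuples j p" for k
    using that assms by (auto simp: increasing_tuples_def PiE_iff)
  have t_sum: "(\<Sum>\<alpha>\<in>compositions p (m + p). t \<alpha> k)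
      = (\<Sum>a=0..m. (recip_fps 1 ^ j) $ a * ((\<Prod>i=j+1..p. recip_fps (k i)) $ (m - a) / real (k p)))"
    if "k p \<ge> 1" for k
  proof -
    have "{1..p} = {1..j} \<union> {j+1..p}" using assms by auto
    then have "(\<Prod>i=1..p. recip_fps (if i \<le> j then 1 else k i))
        = (\<Prod>i=1..j. recip_fps (if i \<le> j then 1 else k i))
          * (\<Prod>i=j+1..p. recip_fps (if i \<le> j then 1 else k i))"
      by (simp only:) (subst prod.union_disjoint; force)
    also have "\<dots> = recip_fps 1 ^ j * (\<Prod>i=j+1..p. recip_fps (k i))" by simp
    finally have split: "(\<Prod>i=1..p. recip_fps (if i \<le> j then 1 else k i))
        = recip_fps 1 ^ j * (\<Prod>i=j+1..p. recip_fps (k i))" .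
    have "(\<Sum>\<alpha>\<in>compositions p (m + p). t \<alpha> k)
        = (recip_fps 1 ^ j * (\<Prod>i=j+1..p. recip_fps (k i))) $ m / real (k p)"
      unfolding t_eq[of k, OF that] sum_divide_distrib[symmetric] sum_compositions_eq_recip_fps split ..
    then show ?thesis by (simp add: fps_mult_nth sum_divide_distrib)
  qed
  have "((\<lambda>k. \<Sum>a=0..m. (recip_fps 1 ^ j) $ a * ((\<Prod>i=j+1..p. recip_fps (k i)) $ (m - a) / real (k p)))
      has_sum (\<Sum>a=0..m. (recip_fps 1 ^ j) $ a * zeta_fps (p - j) $ (m - a))) (increasing_tuples j p)"
    using increasing_tuples_has_sum[OF assms]
    by (intro has_sum_sum has_sum_cmult_right)
  then have total: "((\<lambda>k. \<Sum>\<alpha>\<in>compositions p (m + p). t \<alpha> k) has_sum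
      (recip_fps 1 ^ j * zeta_fps (p - j)) $ m) (increasing_tuples j p)"
    unfolding fps_mult_nth by (rule has_sum_cong[THEN iffD2, rotated]) (rule t_sum[OF tail])
  have t_nonneg: "t \<alpha> k \<ge> 0" for \<alpha> k
    unfolding t_def by (intro mult_nonneg_nonneg prod_nonneg) auto
  have "t \<alpha> summable_on increasing_tuples j p" if "\<alpha> \<in> compositions p (m + p)" for \<alpha>
  proof (rule summable_on_comparison_test)
    show "(\<lambda>k. \<Sum>\<alpha>\<in>compositions p (m + p). t \<alpha> k) summable_on increasing_tuples j p"
      using total by (auto simp: summable_on_def)
    show "t \<alpha> k \<le> (\<Sum>\<alpha>\<in>compositions p (m + p). t \<alpha> k)" for k
      by (rule member_le_sum) (use that t_nonneg finite_compositions in auto)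
  qed (rule t_nonneg)
  then have "((\<lambda>k. \<Sum>\<alpha>\<in>compositions p (m + p). t \<alpha> k) has_sum
      (\<Sum>\<alpha>\<in>compositions p (m + p). infsum (t \<alpha>) (increasing_tuples j p))) (increasing_tuples j p)"
    by (intro has_sum_sum has_sum_infsum)
  then have "(\<Sum>\<alpha>\<in>compositions p (m + p). infsum (t \<alpha>) (increasing_tuples j p))
      = (recip_fps 1 ^ j * zeta_fps (p - j)) $ m"
    using total by (rule has_sum_unique)
  then show ?thesis using assms by (simp add: S_def t_def[abs_def])
qed

section \<open>The alternating sum\<close>

lemma recip_fps_1_mult: "recip_fps 1 * (1 - fps_X) = 1"
  by (rule fps_ext) (simp add: right_diff_distrib recip_fps_def)

lemma recip_fps_1_power_nth:
  assumes "p \<ge> 1"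
  shows "(recip_fps 1 ^ p) $ m = real ((m + p - 1) choose m)"
proof -
  have "recip_fps 1 ^ p * (1 - fps_const 1 * fps_X) ^ p = 1"
    using recip_fps_1_mult by (simp flip: power_mult_distrib)
  then have "recip_fps 1 ^ p = inverse ((1 - fps_const 1 * fps_X) ^ p)"
    by (metis fps_inverse_unique mult.commute)
  then show ?thesis
    using assms by (simp only: one_minus_const_fps_X_neg_power') (simp add: add.commute)
qed

text \<open>The coefficients of \<open>\<Sum>n\<ge>1. n\<^sup>-\<^sup>q (1 / (n - X) - 1 / (n + 1 - X))\<close>.\<close>

definition diff_fps :: "nat \<Rightarrow> real fps" where
  "diff_fps q = Abs_fps (\<lambda>m. \<Sum>n. 1 / real (Suc n) ^ q
     * (1 / real (Suc n) ^ Suc m - 1 / real (Suc (Suc n)) ^ Suc m))"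

lemma inverse_Suc_power_tendsto_0: "(\<lambda>n. 1 / real (Suc n) ^ Suc m) \<longlonglongrightarrow> 0"
proof -
  have "(\<lambda>n. (1 / real (Suc n)) ^ Suc m) \<longlonglongrightarrow> 0 ^ Suc m"
    by (intro tendsto_power LIMSEQ_Suc[OF lim_1_over_n])
  then show ?thesis by (simp add: power_one_over del: power_Suc of_nat_Suc)
qed

lemma diff_fps_summable:
  "summable (\<lambda>n. 1 / real (Suc n) ^ q * (1 / real (Suc n) ^ Suc m - 1 / real (Suc (Suc n)) ^ Suc m))"
proof (rule summable_comparison_test')
  show "summable (\<lambda>n. 1 / real (Suc n) ^ Suc m - 1 / real (Suc (Suc n)) ^ Suc m)"
    using telescope_sums'[OF inverse_Suc_power_tendsto_0] by (rule sums_summable)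
  show "norm (1 / real (Suc n) ^ q * (1 / real (Suc n) ^ Suc m - 1 / real (Suc (Suc n)) ^ Suc m))
      \<le> 1 / real (Suc n) ^ Suc m - 1 / real (Suc (Suc n)) ^ Suc m" if "n \<ge> 0" for n
  proof -
    define c d where "c = 1 / real (Suc n) ^ q"
      and "d = 1 / real (Suc n) ^ Suc m - 1 / real (Suc (Suc n)) ^ Suc m"
    have "0 \<le> c" "c \<le> 1"
      using one_le_power[of "real (Suc n)" q] by (simp_all add: c_def del: of_nat_Suc)
    moreover have "real (Suc n) ^ Suc m \<le> real (Suc (Suc n)) ^ Suc m" by (intro power_mono) auto
    then have "d \<ge> 0"
      unfolding d_def by (simp add: frac_le del: power_Suc of_nat_Suc)
    ultimately have "norm (c * d) \<le> d" by (simp add: mult_left_le_one_le)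
    then show ?thesis by (simp only: c_def d_def)
  qed
qed

lemma diff_fps_0: "diff_fps 0 = recip_fps 1"
proof (rule fps_ext)
  fix m
  from sums_unique[OF telescope_sums'[OF inverse_Suc_power_tendsto_0[of m]]] show "diff_fps 0 $ m = recip_fps 1 $ m"
    by (simp add: diff_fps_def recip_fps_def)
qed

lemma diff_fps_Suc:
  assumes "q \<ge> 1"
  shows "(1 - fps_X) * diff_fps q = zeta_fps q - diff_fps (q - 1)"
proof (rule fps_ext)
  fix m
  obtain r where q: "q = Suc r" using assms by (cases q) auto
  define D where "D i l n = 1 / real (Suc n) ^ i * (1 / real (Suc n) ^ l - 1 / real (Suc (Suc n)) ^ l)"
    for i l n
  have D: "summable (D i l)" for i l
    using diff_fps_summable[of i "l - 1"] by (cases l) (simp_all add: D_def[abs_def])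
  have step: "D q (Suc m) n - D q m n = 1 / real (Suc n) ^ (m + q + 1) - D r (Suc m) n" for n
  proof -
    have "s / a * (t / a - w / b) - s / a * (t - w) = s * t / (a * a) - s * (t / a - w / b)"
      if "a > 0" "b = a + 1" for a b s t w :: real
      using that by (simp add: divide_simps, simp add: algebra_simps)
    from this[of "real (Suc n)" "real (Suc (Suc n))" "1 / real (Suc n) ^ r" "1 / real (Suc n) ^ m"
        "1 / real (Suc (Suc n)) ^ m"]
    show ?thesis by (simp add: D_def q power_add mult_ac)
  qed
  have "((1 - fps_X) * diff_fps q) $ m = (\<Sum>n. D q (Suc m) n) - (\<Sum>n. D q m n)"
    by (cases m) (simp_all add: left_diff_distrib diff_fps_def D_def)
  also have "\<dots> = (\<Sum>n. D q (Suc m) n - D q m n)"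
    by (rule suminf_diff[OF D D])
  also have "\<dots> = (\<Sum>n. 1 / real (Suc n) ^ (m + q + 1)) - (\<Sum>n. D r (Suc m) n)"
    unfolding step using assms by (intro suminf_diff[symmetric] D summable_inverse_Suc_power) simp
  finally show "((1 - fps_X) * diff_fps q) $ m = (zeta_fps q - diff_fps (q - 1)) $ m"
    by (simp add: zeta_fps_def diff_fps_def D_def q)
qed

lemma alternating_sum_fps:
  assumes "p \<ge> 1"
  shows "(\<Sum>j=1..<p. (-1) ^ (j - 1) * recip_fps 1 ^ j * zeta_fps (p - j)) + (-1) ^ (p - 1) * recip_fps 1 ^ p
           = diff_fps (p - 1)"
  using assms
proof (induction p rule: dec_induct)
  case base
  then show ?case by (simp add: diff_fps_0)
next
  case (step p)
  define V where "V = recip_fps 1"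
  have V: "V * (1 - fps_X) = 1" unfolding V_def by (rule recip_fps_1_mult)
  obtain i where p: "p = Suc i" using step.hyps by (cases p) auto
  have "(\<Sum>j=1..<Suc p. (-1) ^ (j - 1) * V ^ j * zeta_fps (Suc p - j))
      = V * zeta_fps p + (\<Sum>j=1..<p. (-1) ^ j * V ^ Suc j * zeta_fps (p - j))"
    using step.hyps
    by (subst sum.atLeast_Suc_lessThan, simp, subst sum.shift_bounds_Suc_ivl) simp
  also have "(\<Sum>j=1..<p. (-1) ^ j * V ^ Suc j * zeta_fps (p - j))
      = - V * (\<Sum>j=1..<p. (-1) ^ (j - 1) * V ^ j * zeta_fps (p - j))"
    unfolding sum_distrib_left
  proof (rule sum.cong)
    fix j assume "j \<in> {1..<p}"
    then show "(-1) ^ j * V ^ Suc j * zeta_fps (p - j)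
        = - V * ((-1) ^ (j - 1) * V ^ j * zeta_fps (p - j))"
      by (cases j) (simp_all add: mult_ac)
  qed simp
  also have "(\<Sum>j=1..<p. (-1) ^ (j - 1) * V ^ j * zeta_fps (p - j)) = diff_fps (p - 1) - (-1) ^ (p - 1) * V ^ p"
    unfolding step.IH[symmetric] V_def by simp
  finally have "(\<Sum>j=1..<Suc p. (-1) ^ (j - 1) * V ^ j * zeta_fps (Suc p - j)) + (-1) ^ (Suc p - 1) * V ^ Suc p
      = V * (zeta_fps p - diff_fps (p - 1))"
    by (simp add: p algebra_simps)
  also have "\<dots> = V * (1 - fps_X) * diff_fps p"
    using diff_fps_Suc[of p] step.hyps by (simp add: mult.assoc)
  also have "\<dots> = diff_fps p" by (simp add: V)
  finally show ?case by (simp add: V_def)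
qed

theorem theorem4p1:
  fixes m p :: nat
  assumes "m \<ge> 1" and "p \<ge> 1"
  shows "(\<Sum>j=1..p. (-1) ^ (j - 1) * S m p j)
       = zeta (real (m + p))
         - (\<Sum>\<^sub>\<infinity>l\<in>{1::nat..}. 1 / (real l ^ (p - 1) * real (l + 1) ^ (m + 1)))"
proof -
  have nth: "((-1) ^ i * F) $ m = (-1) ^ i * F $ m" for i and F :: "real fps"
    by (induction i) simp_all
  have "(\<Sum>j=1..p. (-1) ^ (j - 1) * S m p j)
      = (\<Sum>j=1..<p. (-1) ^ (j - 1) * S m p j) + (-1) ^ (p - 1) * S m p p"
    using assms(2) by (subst sum.last_plus) (simp_all add: add.commute)
  also have "\<dots> = diff_fps (p - 1) $ m"
  proof -
    have "(\<Sum>j=1..<p. (-1) ^ (j - 1) * S m p j)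
        = (\<Sum>j=1..<p. (-1) ^ (j - 1) * recip_fps 1 ^ j * zeta_fps (p - j)) $ m"
      by (simp add: fps_sum_nth nth mult.assoc S_eq_fps_nth)
    moreover have "S m p p = (recip_fps 1 ^ p) $ m"
      unfolding recip_fps_1_power_nth[OF assms(2)] by (simp add: S_def)
    ultimately show ?thesis
      unfolding alternating_sum_fps[OF assms(2), symmetric] by (simp only: fps_add_nth nth)
  qed
  finally have lhs: "(\<Sum>j=1..p. (-1) ^ (j - 1) * S m p j) = diff_fps (p - 1) $ m" .
  have infsum_Suc: "(\<Sum>\<^sub>\<infinity>l\<in>{1::nat..}. f l) = (\<Sum>n. f (Suc n))"
    if "summable (\<lambda>n. f (Suc n))" "\<And>n. f n \<ge> 0" for f :: "nat \<Rightarrow> real"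
  proof -
    have "bij_betw Suc UNIV {1..}"
      by (rule bij_betwI[of _ _ _ "\<lambda>n. n - 1"]) auto
    moreover have "((\<lambda>n. f (Suc n)) has_sum (\<Sum>n. f (Suc n))) UNIV"
      using that by (intro sums_nonneg_imp_has_sum summable_sums)
    ultimately show ?thesis
      using has_sum_reindex_bij_betw infsumI by blast
  qed
  have summ: "summable (\<lambda>n. 1 / real (Suc n) ^ (m + p))"
    by (rule summable_inverse_Suc_power) (use assms in simp)
  have "zeta (real (m + p)) = (\<Sum>\<^sub>\<infinity>l\<in>{1::nat..}. 1 / real l ^ (m + p))"
    unfolding zeta_def by (rule infsum_cong) (auto simp: powr_minus_divide powr_realpow simp del: of_nat_add)
  then have zeta: "zeta (real (m + p)) = (\<Sum>n. 1 / real (Suc n) ^ (m + p))"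
    using infsum_Suc[of "\<lambda>l. 1 / real l ^ (m + p)"] summ by simp
  have split: "1 / (real (Suc n) ^ (p - 1) * real (Suc n + 1) ^ (m + 1)) = 1 / real (Suc n) ^ (m + p)
      - 1 / real (Suc n) ^ (p - 1) * (1 / real (Suc n) ^ Suc m - 1 / real (Suc (Suc n)) ^ Suc m)" for n
  proof -
    have "m + p = (p - 1) + Suc m" using assms by simp
    then show ?thesis by (simp only: power_add) (simp add: algebra_simps)
  qed
  have "(\<Sum>\<^sub>\<infinity>l\<in>{1::nat..}. 1 / (real l ^ (p - 1) * real (l + 1) ^ (m + 1)))
      = (\<Sum>n. 1 / (real (Suc n) ^ (p - 1) * real (Suc n + 1) ^ (m + 1)))"
    by (rule infsum_Suc) (use summable_diff[OF summ diff_fps_summable] in \<open>simp_all only: split, simp_all\<close>)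
  also have "\<dots> = zeta (real (m + p)) - diff_fps (p - 1) $ m"
    unfolding split zeta by (subst suminf_diff[OF summ diff_fps_summable, symmetric]) (simp add: diff_fps_def)
  finally show ?thesis using lhs by simp
qed

end
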